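(* Assume the bounded setting of the context. Let $r,s$ be positive integers with $r\ge sL$, and let $(k(i))_{i\ge1}$ be an increasing sequence of positive integers with $k(i+1)>k(i)+r$ for all $i$. Let $0<\beta<1$, not of the form $n\alpha+m$ with $n,m$ integers, have Davenport coefficients $(b_j)$ satisfying: (1) for each $i\ge1$, $b_{k(i)+1}=b_{k(i)+2}=\dots=b_{k(i)+r}=0$; (2) for each $i\ge1$, there is no block of $N+s$ consecutive zero coefficients $b_j$ with all indices $j$ satisfying $k(i)+r<j<k(i+1)$; (3) $(b_j)$ contains no block of the form $a_j-1,a_{j+1}-2,\dots,a_{j+N+s-1}-2$. Then $\mathcal M_+(\alpha,\beta)=\liminf_{i\to\infty}\lambda_{k(i)}(\beta)$.
   Context: $\|x\|$ is the distance to the nearest integer, $\mathcal M_+(\alpha,\beta)=\liminf_{q\to\infty}q\|q\alpha-\beta\|$ over positive integers $q$. $\alpha\in(0,1)$ is irrational with negative continued fraction $\alpha_1=\alpha$, $a_i=\lceil1/\alpha_i\rceil$, $\alpha_{i+1}=a_i-1/\alpha_i$; $q_{-1}=0$, $q_0=1$, $q_i=a_iq_{i-1}-q_{i-2}$; $D_0=1$, $D_i=\alpha_1\cdots\alpha_i$. Bounded setting: $(a_i)$ is bounded with $M=\sup a_i$, and $(a_i)$ has no $N$ consecutive $2$'s, where $N-1\ge0$ is the least upper bound of lengths of blocks of consecutive $2$'s. $R=N/(N+1)$, $L$ is the smallest integer with $R^L\le(1-R)(1-R^2)/(M^N(M^2-1))$. Davenport expansion of $\beta\in[0,1)$: $\beta_1=\beta$,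 $b_i=\lfloor\beta_i/\alpha_i\rfloor$, $\beta_{i+1}=\beta_i/\alpha_i-b_i$. $Q_n=\sum_{k=1}^nb_kq_{k-1}$ and $\lambda_n(\beta)=Q_nD_n\beta_{n+1}$. *)

theory Defs
  imports "HOL-Analysis.Analysis"
begin

text \<open>
  All sequences below are indexed from 1, as is customary for the negative continued fraction;
  the values at index 0 of \<open>ncf_rem\<close> and \<open>dav_rem\<close> are dummies.
\<close>

fun ncf_rem :: "real \<Rightarrow> nat \<Rightarrow> real" where
  "ncf_rem \<alpha> 0 = 0"
| "ncf_rem \<alpha> (Suc 0) = \<alpha>"
| "ncf_rem \<alpha> (Suc (Suc i)) = of_int \<lceil>1 / ncf_rem \<alpha> (Suc i)\<rceil> - 1 / ncf_rem \<alpha> (Suc i)"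

definition ncf_coeff :: "real \<Rightarrow> nat \<Rightarrow> int" where
  "ncf_coeff \<alpha> i = \<lceil>1 / ncf_rem \<alpha> i\<rceil>"

text \<open>
  The recursion \<open>q\<^sub>i = a\<^sub>i q\<^sub>i\<^sub>-\<^sub>1 - q\<^sub>i\<^sub>-\<^sub>2\<close> starts from \<open>q\<^sub>-\<^sub>1 = 0\<close> and \<open>q\<^sub>0 = 1\<close>;
  the index \<open>-1\<close> is avoided by evaluating the case \<open>i = 1\<close>.
\<close>

fun ncf_denom :: "real \<Rightarrow> nat \<Rightarrow> int" where
  "ncf_denom \<alpha> 0 = 1"
| "ncf_denom \<alpha> (Suc 0) = ncf_coeff \<alpha> 1"
| "ncf_denom \<alpha> (Suc (Suc i)) =
     ncf_coeff \<alpha> (Suc (Suc i)) * ncf_denom \<alpha> (Suc i) - ncf_denom \<alpha> i"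

definition ncf_D :: "real \<Rightarrow> nat \<Rightarrow> real" where
  "ncf_D \<alpha> i = (\<Prod>j=1..i. ncf_rem \<alpha> j)"

fun dav_rem :: "real \<Rightarrow> real \<Rightarrow> nat \<Rightarrow> real" where
  "dav_rem \<alpha> \<beta> 0 = 0"
| "dav_rem \<alpha> \<beta> (Suc 0) = \<beta>"
| "dav_rem \<alpha> \<beta> (Suc (Suc i)) =
     dav_rem \<alpha> \<beta> (Suc i) / ncf_rem \<alpha> (Suc i)
       - of_int \<lfloor>dav_rem \<alpha> \<beta> (Suc i) / ncf_rem \<alpha> (Suc i)\<rfloor>"

definition dav_coeff :: "real \<Rightarrow> real \<Rightarrow> nat \<Rightarrow> int" where
  "dav_coeff \<alpha> \<beta> i = \<lfloor>dav_rem \<alpha> \<beta> i / ncf_rem \<alpha> i\<rfloor>"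

definition dav_Q :: "real \<Rightarrow> real \<Rightarrow> nat \<Rightarrow> int" where
  "dav_Q \<alpha> \<beta> n = (\<Sum>k=1..n. dav_coeff \<alpha> \<beta> k * ncf_denom \<alpha> (k - 1))"

definition dav_lambda :: "real \<Rightarrow> real \<Rightarrow> nat \<Rightarrow> real" where
  "dav_lambda \<alpha> \<beta> n = of_int (dav_Q \<alpha> \<beta> n) * ncf_D \<alpha> n * dav_rem \<alpha> \<beta> (n + 1)"

text \<open>
  The limit inferior is taken in the extended reals, so that no boundedness is presupposed.
  \<open>infdist x \<int>\<close> is the distance from \<open>x\<close> to the nearest integer.
\<close>

definition M_plus :: "real \<Rightarrow> real \<Rightarrow> ereal" where
  "M_plus \<alpha> \<beta> =
     liminf (\<lambda>q::nat. ereal (real q * infdist (real q * \<alpha> - \<beta>) \<int>))"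

definition two_block_lengths :: "real \<Rightarrow> nat set" where
  "two_block_lengths \<alpha> = {l. \<exists>i\<ge>1. \<forall>j\<in>{i..<i+l}. ncf_coeff \<alpha> j = 2}"

text \<open>The suprema below are meaningful only under \<open>ncf_bounded\<close>.\<close>

definition ncf_bounded :: "real \<Rightarrow> bool" where
  "ncf_bounded \<alpha> \<longleftrightarrow>
     bdd_above (ncf_coeff \<alpha> ` {1..}) \<and> bdd_above (two_block_lengths \<alpha>)"

definition ncf_M :: "real \<Rightarrow> int" where
  "ncf_M \<alpha> = (SUP i\<in>{1..}. ncf_coeff \<alpha> i)"

definition ncf_N :: "real \<Rightarrow> nat" where
  "ncf_N \<alpha> = Sup (two_block_lengths \<alpha>) + 1"

definition ncf_R :: "real \<Rightarrow> real" where
  "ncf_R \<alpha> = real (ncf_N \<alpha>) / (real (ncf_N \<alpha>) + 1)"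

definition ncf_L :: "real \<Rightarrow> int" where
  "ncf_L \<alpha> = (LEAST l::int.
     ncf_R \<alpha> powi l \<le>
       (1 - ncf_R \<alpha>) * (1 - ncf_R \<alpha> ^ 2)
         / (of_int (ncf_M \<alpha>) ^ ncf_N \<alpha> * (of_int (ncf_M \<alpha>) ^ 2 - 1)))"

end

theory Submission
  imports Defs
begin

text \<open>
  The vectors \<open>v\<^sub>n = (q\<^sub>n\<^sub>-\<^sub>1, D\<^sub>n)\<close> and \<open>v\<^sub>n\<^sub>+\<^sub>1\<close> form a basis of the lattice of all \<open>(t, t\<alpha> - p)\<close>, and
  \<open>(Q\<^sub>n, - D\<^sub>n \<beta>\<^sub>n\<^sub>+\<^sub>1)\<close> is a point of its translate by \<open>(0, - \<beta>)\<close>. For an integer \<open>j\<close> with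
  \<open>Q\<^sub>n + q\<^sub>n\<^sub>-\<^sub>1 \<le> j < Q\<^sub>n\<^sub>+\<^sub>1 + q\<^sub>n\<close>, coordinates with respect to this basis show that \<open>j \<parallel>j\<alpha> - \<beta>\<parallel>\<close> is at
  least \<open>\<lambda>\<^sub>n\<close> or \<open>\<lambda>\<^sub>n\<^sub>+\<^sub>1\<close>, or at least \<open>q\<^sub>n\<^sub>-\<^sub>1 D\<^sub>n\<close> times \<open>1 - \<beta>\<^sub>n\<^sub>+\<^sub>1\<close> or \<open>1 - \<alpha>\<^sub>n\<^sub>+\<^sub>1\<close>. Condition (3) keeps
  \<open>\<beta>\<^sub>n\<^sub>+\<^sub>1\<close> away from \<open>1\<close>, so the last two quantities exceed a constant \<open>K\<close>. If \<open>k(i) \<le> n \<le> k(i+1)\<close>, then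
  either \<open>\<lambda>\<^sub>n\<close> equals \<open>\<lambda>\<close> at one of the two ends, because only zero digits lie in between, or \<open>n\<close> lies
  in a run of fewer than \<open>N + s\<close> zeros and \<open>\<lambda>\<^sub>n \<ge> K\<close>. Finally \<open>\<lambda>\<^sub>k\<^sub>(\<^sub>i\<^sub>) \<le> R\<^sup>r / (1 - R\<^sup>2) \<le> K\<close> for large \<open>i\<close> by
  the choice of \<open>L\<close>.
\<close>

subsection \<open>Negative continued fractions\<close>

locale ncf =
  fixes \<alpha> :: real
  assumes pos: "0 < \<alpha>" and less_1: "\<alpha> < 1" and irrational: "\<alpha> \<notin> \<rat>"
begin

abbreviation "A \<equiv> ncf_rem \<alpha>"
abbreviation "a i \<equiv> real_of_int (ncf_coeff \<alpha> i)"
abbreviation "q i \<equiv> real_of_int (ncf_denom \<alpha> i)"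
abbreviation "D \<equiv> ncf_D \<alpha>"

lemma rem_Suc: "i \<ge> 1 \<Longrightarrow> A (Suc i) = a i - 1 / A i"
  by (cases i) (auto simp: ncf_coeff_def)

text \<open>Irrationality is carried through the induction because the ceiling alone gives 0 \<le>
  \<open>A i\<close> < 1; it is what excludes 0.\<close>

lemma rem_Suc_in: "A (Suc i) \<notin> \<rat> \<and> 0 < A (Suc i) \<and> A (Suc i) < 1"
proof (induction i)
  case 0
  then show ?case using pos less_1 irrational by simp
next
  case (Suc i)
  let ?y = "1 / A (Suc i)"
  have y: "?y \<notin> \<rat>"
  proof
    assume "?y \<in> \<rat>"
    then have "1 / ?y \<in> \<rat>" using Rats_divide[OF Rats_1] by blast
    then show False using Suc by (simp del: ncf_rem.simps)
  qed
  have e: "A (Suc (Suc i)) = of_int \<lceil>?y\<rceil> - ?y" by simp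
  have "A (Suc (Suc i)) \<notin> \<rat>"
  proof
    assume "A (Suc (Suc i)) \<in> \<rat>"
    then have "of_int \<lceil>?y\<rceil> - A (Suc (Suc i)) \<in> \<rat>" by (intro Rats_diff Rats_of_int)
    then show False using y by (simp add: e del: ncf_rem.simps)
  qed
  moreover have "A (Suc (Suc i)) \<noteq> 0" using calculation by (metis Rats_0)
  moreover have "0 \<le> A (Suc (Suc i))" "A (Suc (Suc i)) < 1" unfolding e by linarith+
  ultimately show ?case by (simp del: ncf_rem.simps)
qed

lemma rem_pos: "i \<ge> 1 \<Longrightarrow> 0 < A i" and rem_less_1: "i \<ge> 1 \<Longrightarrow> A i < 1"
  using rem_Suc_in[of "i - 1"] by auto

lemma rem_mult: "i \<ge> 1 \<Longrightarrow> A i * (a i - A (Suc i)) = 1"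
  using rem_pos[of i] by (simp add: rem_Suc field_simps)

lemma coeff_ge_2: "i \<ge> 1 \<Longrightarrow> ncf_coeff \<alpha> i \<ge> 2"
proof -
  assume i: "i \<ge> 1"
  have "1 < 1 / A i" using rem_pos[OF i] rem_less_1[OF i] by simp
  then show ?thesis unfolding ncf_coeff_def by linarith
qed

section \<open>The sequences \<open>q\<close> and \<open>D\<close> and the lattice they
  generate\<close>

lemma D_0: "D 0 = 1" by (simp add: ncf_D_def)

lemma D_Suc: "D (Suc n) = D n * A (Suc n)" by (simp add: ncf_D_def)

lemma D_pos: "0 < D n"
  by (induction n) (auto simp: D_0 D_Suc rem_pos)

text \<open>This is \<open>rem_mult\<close> times \<open>D n\<close>. It is the recurrence of
  \<open>q\<close> shifted by one index, which is why \<open>D (Suc n)\<close> is paired with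
  \<open>q n\<close> below.\<close>

lemma D_rec: "D (Suc (Suc n)) = a (Suc n) * D (Suc n) - D n"
proof -
  have "D n = D n * (A (Suc n) * (a (Suc n) - A (Suc (Suc n))))"
    using rem_mult[of "Suc n"] by simp
  also have "\<dots> = a (Suc n) * D (Suc n) - D (Suc (Suc n))" by (simp add: D_Suc algebra_simps)
  finally show ?thesis by simp
qed

lemma D_2: "D (Suc (Suc 0)) = a (Suc 0) * \<alpha> - 1"
  using D_rec[of 0] by (simp add: D_Suc D_0)

lemma q_rec: "q (Suc (Suc n)) = a (Suc (Suc n)) * q (Suc n) - q n"
  by simp

text \<open>As every coefficient is at least 2, the increments of \<open>q\<close> never
  decrease.\<close>

lemma q_growth: "q n \<ge> 1 \<and> q (Suc n) \<ge> q n + 1"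
proof (induction n)
  case 0
  then show ?case using coeff_ge_2[of 1] by simp
next
  case (Suc n)
  have "a (Suc (Suc n)) * q (Suc n) \<ge> 2 * q (Suc n)"
    using Suc coeff_ge_2[of "Suc (Suc n)"] by (intro mult_right_mono) auto
  then show ?case using Suc q_rec[of n] by linarith
qed

lemma q_ge_1: "q n \<ge> 1" and q_Suc_ge: "q (Suc n) \<ge> q n + 1"
  using q_growth by auto

lemma q_ge: "q n \<ge> real n + 1"
proof (induction n)
  case (Suc n)
  then show ?case using q_Suc_ge[of n] by simp
qed simp

text \<open>Both coordinates of \<open>(q n, D (Suc n))\<close> obey the same recurrence, whose step
  has determinant 1, so the determinant of consecutive vectors is constant.\<close>

lemma det: "q (Suc n) * D (Suc n) - q n * D (Suc (Suc n)) = 1"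
proof (induction n)
  case 0
  show ?case by (simp add: D_2 D_0 D_Suc[of 0])
next
  case (Suc n)
  show ?case using Suc unfolding q_rec D_rec[of "Suc n"] by (simp add: algebra_simps)
qed

lemma q_mult_D_ge_1: "q n * D n \<ge> 1"
proof (cases n)
  case 0
  then show ?thesis by (simp add: D_0)
next
  case (Suc m)
  have "0 \<le> q m * D (Suc (Suc m))"
    using q_ge_1[of m] D_pos[of "Suc (Suc m)"] by (intro mult_nonneg_nonneg) auto
  then show ?thesis unfolding Suc using det[of m] by linarith
qed

lemma D_eq: "\<exists>p::int. D (Suc n) = q n * \<alpha> - of_int p"
proof -
  have "(\<exists>p::int. D (Suc n) = q n * \<alpha> - of_int p) \<and>
        (\<exists>p::int. D (Suc (Suc n)) = q (Suc n) * \<alpha> - of_int p)"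
  proof (induction n)
    case 0
    have "D (Suc 0) = q 0 * \<alpha> - of_int 0" by (simp add: D_Suc D_0)
    moreover have "D (Suc (Suc 0)) = q (Suc 0) * \<alpha> - of_int 1" by (simp add: D_2)
    ultimately show ?case by metis
  next
    case (Suc n)
    then obtain p p' :: int where p: "D (Suc n) = q n * \<alpha> - of_int p"
      "D (Suc (Suc n)) = q (Suc n) * \<alpha> - of_int p'" by blast
    have "D (Suc (Suc (Suc n))) =
        q (Suc (Suc n)) * \<alpha> - of_int (ncf_coeff \<alpha> (Suc (Suc n)) * p' - p)"
      unfolding D_rec[of "Suc n"] p by (simp add: algebra_simps)
    then show ?case using Suc by blast
  qed
  then show ?thesis by blast
qed

lemma lattice_basis:
  fixes t p :: int
  shows "\<exists>x y :: int. of_int t = of_int x * q (Suc n) + of_int y * q n \<and>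
           of_int t * \<alpha> - of_int p = of_int x * D (Suc (Suc n)) + of_int y * D (Suc n)"
proof (induction n)
  case 0
  show ?case
    by (rule exI[of _ "p"], rule exI[of _ "t - ncf_coeff \<alpha> (Suc 0) * p"])
      (simp add: D_2 D_Suc[of 0] D_0 algebra_simps)
next
  case (Suc n)
  then obtain x y :: int where xy: "of_int t = of_int x * q (Suc n) + of_int y * q n"
    "of_int t * \<alpha> - of_int p = of_int x * D (Suc (Suc n)) + of_int y * D (Suc n)" by blast
  \<comment> \<open>The witnesses come from substituting
    \<open>q n = a (Suc (Suc n)) * q (Suc n) - q (Suc (Suc n))\<close>, and likewise for
    \<open>D\<close>, into the old coordinates.\<close>
  show ?case
    by (rule exI[of _ "- y"], rule exI[of _ "x + ncf_coeff \<alpha> (Suc (Suc n)) * y"])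
      (intro conjI, simp only: xy(1) q_rec, simp add: algebra_simps,
        simp only: xy(2) D_rec[of "Suc n"], simp add: algebra_simps)
qed

end

subsection \<open>Davenport expansions\<close>

locale davenport = ncf +
  fixes \<beta> :: real
  assumes \<beta>_nonneg: "0 \<le> \<beta>" and \<beta>_less_1: "\<beta> < 1"
begin

abbreviation "B \<equiv> dav_rem \<alpha> \<beta>"
abbreviation "b i \<equiv> real_of_int (dav_coeff \<alpha> \<beta> i)"
abbreviation "Q i \<equiv> real_of_int (dav_Q \<alpha> \<beta> i)"
abbreviation "lam \<equiv> dav_lambda \<alpha> \<beta>"

lemma dav_rem_Suc_in: "0 \<le> B (Suc i) \<and> B (Suc i) < 1"
proof (cases i)
  case 0
  then show ?thesis using \<beta>_nonneg \<beta>_less_1 by simp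
next
  case (Suc j)
  then show ?thesis by simp linarith
qed

lemma dav_rem_nonneg: "i \<ge> 1 \<Longrightarrow> 0 \<le> B i" and dav_rem_less_1: "i \<ge> 1 \<Longrightarrow> B i < 1"
  using dav_rem_Suc_in[of "i - 1"] by auto

lemma dav_rem_rec: "i \<ge> 1 \<Longrightarrow> B i = A i * (b i + B (Suc i))"
  using rem_pos[of i] by (cases i) (auto simp: dav_coeff_def)

lemma dav_coeff_nonneg: "i \<ge> 1 \<Longrightarrow> dav_coeff \<alpha> \<beta> i \<ge> 0"
  unfolding dav_coeff_def using dav_rem_nonneg[of i] rem_pos[of i] by simp

lemma dav_coeff_less: "i \<ge> 1 \<Longrightarrow> dav_coeff \<alpha> \<beta> i < ncf_coeff \<alpha> i"
proof -
  assume i: "i \<ge> 1"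
  have "B i / A i < 1 / A i" 
    using dav_rem_less_1[OF i] rem_pos[OF i] by (intro divide_strict_right_mono)
  also have "\<dots> \<le> a i" unfolding ncf_coeff_def by (rule le_of_int_ceiling)
  finally show ?thesis unfolding dav_coeff_def by (simp add: floor_less_iff)
qed

text \<open>The sign of this slack decides which digits may precede index \<open>i\<close>; by
  \<open>w_rec\<close> a digit \<open>a i - 2\<close> merely rescales it by
  \<open>A i\<close>.\<close>

abbreviation "w i \<equiv> 1 - A i - B i"

lemma w_rec: "i \<ge> 1 \<Longrightarrow> w i = A i * (a i - 2 - b i + w (Suc i))"
  and one_minus_dav_rem: "i \<ge> 1 \<Longrightarrow> 1 - B i = A i * (a i - 1 - b i + w (Suc i))"
  using rem_mult[of i] dav_rem_rec[of i]
  by (simp_all add: algebra_simps del: dav_rem.simps ncf_rem.simps)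

text \<open>With this digit the bracket in \<open>w_rec\<close> is
  \<open>- A (Suc i) - B (Suc i)\<close>. Together with the next lemma this excludes blocks
  \<open>a - 1, a - 2, ..., a - 2, a - 1\<close>.\<close>

lemma w_neg_if_last_digit:
  assumes "i \<ge> 1" and "dav_coeff \<alpha> \<beta> i = ncf_coeff \<alpha> i - 1"
  shows "w i < 0"
proof -
  have "a i - 2 - b i + w (Suc i) < 0"
    using assms rem_pos[of "Suc i"] dav_rem_nonneg[of "Suc i"] by simp
  then show ?thesis using rem_pos[of i] assms w_rec[of i] by (simp add: mult_pos_neg)
qed

lemma not_last_digit_if_w_neg:
  assumes "i \<ge> 1" and "w (Suc i) < 0"
  shows "dav_coeff \<alpha> \<beta> i \<le> ncf_coeff \<alpha> i - 2"
proof -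
  have "0 < A i * (a i - 1 - b i + w (Suc i))"
    using one_minus_dav_rem[of i] dav_rem_less_1[of i] assms(1) by simp
  then have "0 < a i - 1 - b i" 
    using rem_pos[of i] assms by (simp add: zero_less_mult_iff del: dav_rem.simps ncf_rem.simps)
  then show ?thesis by linarith
qed

section \<open>Partial sums \<open>Q\<close> and the grid points they give\<close>

lemma Q_0: "Q 0 = 0" by (simp add: dav_Q_def)

lemma Q_Suc: "Q (Suc n) = Q n + b (Suc n) * q n" by (simp add: dav_Q_def)

lemma Q_mono: "m \<le> n \<Longrightarrow> Q m \<le> Q n"
proof (induction rule: dec_induct)
  case (step n)
  have "0 \<le> b (Suc n) * q n"
    using dav_coeff_nonneg[of "Suc n"] q_ge_1[of n] by (intro mult_nonneg_nonneg) auto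
  then show ?case using step Q_Suc[of n] by linarith
qed simp

lemma Q_nonneg: "Q n \<ge> 0"
  using Q_mono[of 0 n] by (simp add: Q_0)

lemma Q_ge: "dav_coeff \<alpha> \<beta> (Suc n) \<noteq> 0 \<Longrightarrow> Q (Suc n) \<ge> q n"
proof -
  assume "dav_coeff \<alpha> \<beta> (Suc n) \<noteq> 0"
  then have "1 \<le> b (Suc n)" using dav_coeff_nonneg[of "Suc n"] by simp
  then have "1 * q n \<le> b (Suc n) * q n" using q_ge_1[of n] by (intro mult_right_mono) auto
  then show ?thesis using Q_Suc[of n] Q_nonneg[of n] by linarith
qed

text \<open>The tail of the expansion of \<beta> into multiples of the \<open>D k\<close> is
  \<open>D n * B (Suc n)\<close>, and \<open>D (Suc k)\<close> differs from
  \<open>q k * \<alpha>\<close> by an integer.\<close>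

lemma Q_approx: "\<exists>p::int. Q n * \<alpha> - of_int p - \<beta> = - D n * B (Suc n)"
proof (induction n)
  case 0
  show ?case by (rule exI[of _ 0]) (simp add: Q_0 D_0)
next
  case (Suc n)
  then obtain p :: int where p: "Q n * \<alpha> - of_int p - \<beta> = - D n * B (Suc n)" by blast
  obtain p' :: int where p': "D (Suc n) = q n * \<alpha> - of_int p'" using D_eq by blast
  have "Q (Suc n) * \<alpha> - of_int (p + dav_coeff \<alpha> \<beta> (Suc n) * p') - \<beta>
      = - D n * B (Suc n) + b (Suc n) * D (Suc n)"
    using p by (simp add: Q_Suc p' algebra_simps)
  also have "\<dots> = - D (Suc n) * B (Suc (Suc n))"
    using dav_rem_rec[of "Suc n"] by (simp add: D_Suc algebra_simps del: dav_rem.simps)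
  finally show ?case by blast
qed

lemma D_mult_dav_rem: "D n * B (Suc n) = D (Suc n) * (b (Suc n) + B (Suc (Suc n)))"
  using dav_rem_rec[of "Suc n"] by (simp add: D_Suc algebra_simps del: dav_rem.simps)

lemma lam_eq: "lam n = Q n * D n * B (Suc n)"
  by (simp add: dav_lambda_def)

lemma zero_block:
  assumes "m \<le> n" and "\<And>j. m < j \<Longrightarrow> j \<le> n \<Longrightarrow> dav_coeff \<alpha> \<beta> j = 0"
  shows "Q n = Q m" and "D n * B (Suc n) = D m * B (Suc m)"
proof -
  have "Q n = Q m \<and> D n * B (Suc n) = D m * B (Suc m)"
    using assms
  proof (induction rule: dec_induct)
    case (step n)
    have "dav_coeff \<alpha> \<beta> (Suc n) = 0" using step by simp
    then show ?case using step Q_Suc[of n] D_mult_dav_rem[of n] by simp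
  qed simp
  then show "Q n = Q m" "D n * B (Suc n) = D m * B (Suc m)" by auto
qed

lemma zero_block_lam:
  assumes "m \<le> n" and "\<And>j. m < j \<Longrightarrow> j \<le> n \<Longrightarrow> dav_coeff \<alpha> \<beta> j = 0"
  shows "lam n = lam m"
  using zero_block[OF assms] by (simp add: lam_eq mult.assoc)

text \<open>The grid point \<open>(j, j\<alpha> - p - \<beta>)\<close> is reached from \<open>(Q\<^sub>n, - D\<^sub>n \<beta>\<^sub>n\<^sub>+\<^sub>1)\<close>, where \<open>n = Suc m\<close>, by
  \<open>x (q\<^sub>n, D\<^sub>n\<^sub>+\<^sub>1) + y (q\<^sub>n\<^sub>-\<^sub>1, D\<^sub>n)\<close>; the three alternatives correspond to \<open>y = 0\<close>, where the product is
  concave in \<open>x\<close>, to \<open>y > 0\<close> and to \<open>y < 0\<close>.\<close>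

lemma product_lower_bound:
  fixes j p :: int
  assumes lower: "Q (Suc m) + q m \<le> of_int j" and upper: "of_int j < Q (Suc (Suc m)) + q (Suc m)"
  defines "P \<equiv> of_int j * \<bar>of_int j * \<alpha> - of_int p - \<beta>\<bar>"
  shows "P \<ge> lam (Suc m) \<or> P \<ge> lam (Suc (Suc m)) \<or>
    P \<ge> q m * D (Suc m) * (1 - B (Suc (Suc m))) \<or>
    P \<ge> q m * D (Suc m) * (1 - A (Suc (Suc m)))"
proof -
  define n where "n = Suc m"
  define Al where "Al = A (Suc n)"
  define \<beta>1 where "\<beta>1 = B (Suc n)"
  define \<beta>2 where "\<beta>2 = B (Suc (Suc n))"
  define c where "c = b (Suc n)"
  have Al: "0 < Al" "Al < 1" unfolding Al_def using rem_pos rem_less_1 by auto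
  have \<beta>1: "0 \<le> \<beta>1" "\<beta>1 < 1" unfolding \<beta>1_def using dav_rem_Suc_in by blast+
  have \<beta>2: "0 \<le> \<beta>2" "\<beta>2 < 1" unfolding \<beta>2_def using dav_rem_Suc_in by blast+
  have rec: "\<beta>1 = Al * (c + \<beta>2)"
    unfolding \<beta>1_def \<beta>2_def Al_def c_def using dav_rem_rec[of "Suc n"] by simp
  have Dn: "0 < D n" by (rule D_pos)
  have DSn: "D (Suc n) = D n * Al" by (simp add: D_Suc Al_def)
  have qm: "1 \<le> q m" "q m + 1 \<le> q n" unfolding n_def by (rule q_ge_1, rule q_Suc_ge)
  have Qn: "0 \<le> Q n" by (rule Q_nonneg)
  have QSn: "Q (Suc n) = Q n + c * q n" by (simp add: Q_Suc c_def)
  obtain p0 :: int where p0: "Q n * \<alpha> - of_int p0 - \<beta> = - D n * \<beta>1"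
    unfolding \<beta>1_def using Q_approx by blast
  obtain x y :: int where
    xy: "of_int (j - dav_Q \<alpha> \<beta> n) = of_int x * q n + of_int y * q m"
      "of_int (j - dav_Q \<alpha> \<beta> n) * \<alpha> - of_int (p - p0) = of_int x * D (Suc n) + of_int y * D n"
    using lattice_basis[of "j - dav_Q \<alpha> \<beta> n" m "p - p0"] unfolding n_def by blast
  have j: "of_int j = Q n + of_int x * q n + of_int y * q m" using xy(1) by simp
  define v where "v = of_int j * \<alpha> - of_int p - \<beta>"
  have v: "v = D n * (of_int x * Al + of_int y - \<beta>1)"
    using xy(2) p0 unfolding v_def DSn by (simp add: algebra_simps)
  have P: "P = of_int j * \<bar>v\<bar>" by (simp add: P_def v_def)
  have lo: "Q n + q m \<le> of_int j" using lower by (simp add: n_def)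
  have up: "of_int j < Q n + (c + 1) * q n"
    using upper QSn by (simp add: n_def algebra_simps)
  have key: "P \<ge> q m * D n * w" if "\<bar>v\<bar> \<ge> D n * w" "w \<ge> 0" for w
  proof -
    have "q m * (D n * w) \<le> of_int j * \<bar>v\<bar>"
      using that lo Qn qm Dn by (intro mult_mono) auto
    then show ?thesis by (simp add: P mult.assoc)
  qed
  consider "y = 0" | "y \<ge> 1" | "y \<le> - 1" by linarith
  then show ?thesis
  proof cases
    case 1
    have xq: "of_int x * q n < (c + 1) * q n" using up j 1 by simp
    then have "of_int x < c + 1" using qm by (simp add: mult_less_cancel_right)
    then have "x \<le> dav_coeff \<alpha> \<beta> (Suc n)" by (simp add: int_le_real_less c_def)
    then have xc: "of_int x \<le> c" by (simp add: c_def)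
    have "0 < of_int x * q n" using lo j 1 qm by simp
    then have x0: "0 < real_of_int x" using qm by (simp add: zero_less_mult_iff)
    have v': "\<bar>v\<bar> = D n * Al * (c - of_int x + \<beta>2)"
    proof -
      have "v = - (D n * Al * (c - of_int x + \<beta>2))"
        using v rec 1 by (simp add: algebra_simps)
      moreover have "0 \<le> D n * Al * (c - of_int x + \<beta>2)" using Dn Al xc \<beta>2 by simp
      ultimately show ?thesis by simp
    qed
    have P': "P = D n * Al * ((Q n + of_int x * q n) * (c - of_int x + \<beta>2))"
      using P j 1 v' by simp
    have l1: "lam n = D n * Al * (Q n * (c + \<beta>2))"
      unfolding lam_eq \<beta>1_def[symmetric] rec by simp
    have l2: "lam (Suc n) = D n * Al * ((Q n + c * q n) * \<beta>2)"
      unfolding lam_eq \<beta>2_def[symmetric] QSn DSn by simp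
    have DA: "0 \<le> D n * Al" using Dn Al by simp
    show ?thesis
    \<comment> \<open>Up to the factor \<open>D n * Al\<close>, \<open>P\<close> minus its value at
      \<open>x = 0\<close> is \<open>x * (q n * (c - x + \<beta>2) - Q n)\<close>, and
      \<open>P\<close> minus its value at \<open>x = c\<close> is
      \<open>(c - x) * (Q n + x * q n - \<beta>2 * q n)\<close>. If the first is negative, the
      second is not.\<close>
    proof (cases "Q n \<le> q n * (c - of_int x + \<beta>2)")
      case True
      have "0 \<le> of_int x * (q n * (c - of_int x + \<beta>2) - Q n)" using x0 True by simp
      then have "Q n * (c + \<beta>2) \<le> (Q n + of_int x * q n) * (c - of_int x + \<beta>2)"
        by (simp add: algebra_simps)
      then have "lam n \<le> P" unfolding l1 P' by (rule mult_left_mono[OF _ DA])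
      then show ?thesis by (simp add: n_def)
    next
      case False
      have "0 \<le> q n * (c - of_int x)" "0 \<le> q n * of_int x" using qm xc x0 by simp_all
      then have "0 \<le> Q n + of_int x * q n - \<beta>2 * q n" using False by (simp add: algebra_simps)
      then have "0 \<le> (c - of_int x) * (Q n + of_int x * q n - \<beta>2 * q n)" using xc by simp
      then have "(Q n + c * q n) * \<beta>2 \<le> (Q n + of_int x * q n) * (c - of_int x + \<beta>2)"
        by (simp add: algebra_simps)
      then have "lam (Suc n) \<le> P" unfolding l2 P' by (rule mult_left_mono[OF _ DA])
      then show ?thesis by (simp add: n_def)
    qed
  next
    case 2
    have "of_int x * Al + of_int y \<ge> 1"
    proof (cases "x \<ge> 0")
      case True
      then have "0 \<le> of_int x * Al" using Al by simp
      then show ?thesis using 2 by linarith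
    next
      case False
      \<comment> \<open>A negative \<open>x\<close> must be compensated by \<open>y\<close>: the
        lower bound on \<open>j\<close> and \<open>q m < q n\<close> force
        \<open>- x < y - 1\<close>, while \<open>Al < 1\<close>.\<close>
      have "- of_int x * q m < - of_int x * q n" using False qm by (intro mult_strict_left_mono) auto
      also have "\<dots> \<le> (of_int y - 1) * q m" using lo j by (simp add: algebra_simps)
      finally have "- real_of_int x * q m < (of_int y - 1) * q m" .
      then have "- of_int x < (of_int y - 1 :: real)"
        using qm by (simp only: mult_less_cancel_right)
      moreover have "of_int x * 1 \<le> of_int x * Al" using False Al by (intro mult_left_mono_neg) auto
      ultimately show ?thesis by linarith
    qed
    then have "v \<ge> D n * (1 - \<beta>1)" unfolding v using Dn by (intro mult_left_mono) auto
    then have "P \<ge> q m * D n * (1 - \<beta>1)" using \<beta>1 by (intro key) auto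
    then show ?thesis by (simp add: n_def \<beta>1_def)
  next
    case 3
    \<comment> \<open>Replacing \<open>q m\<close> by \<open>q n\<close> yields
      \<open>x \<le> c - y\<close>; each unit of \<open>- y\<close> then pushes \<open>v\<close>
      down by at least \<open>D n * (1 - Al)\<close>.\<close>
    have "of_int x * q n < (c + 1) * q n + - of_int y * q m" using up j by simp
    also have "\<dots> \<le> (c + 1) * q n + - of_int y * q n"
      using 3 qm by (intro add_left_mono mult_left_mono) auto
    also have "\<dots> = (c + 1 - of_int y) * q n" by (simp add: algebra_simps)
    finally have "of_int x < c + 1 - of_int y" using qm by (simp add: mult_less_cancel_right)
    then have "x \<le> dav_coeff \<alpha> \<beta> (Suc n) - y" by (simp add: int_le_real_less c_def)
    then have "of_int x \<le> c - of_int y" by (simp add: c_def)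
    then have "of_int x * Al \<le> (c - of_int y) * Al" using Al by (intro mult_right_mono) auto
    moreover have "(- of_int y - 1) * (1 - Al) \<ge> 0" using 3 Al by simp
    moreover have "0 \<le> Al * \<beta>2" using Al \<beta>2 by simp
    ultimately have "1 - Al \<le> - (of_int x * Al + of_int y - \<beta>1)"
      unfolding rec by (simp add: algebra_simps)
    then have "D n * (1 - Al) \<le> D n * - (of_int x * Al + of_int y - \<beta>1)"
      using Dn by (intro mult_left_mono) auto
    then have "\<bar>v\<bar> \<ge> D n * (1 - Al)" unfolding v by linarith
    then have "P \<ge> q m * D n * (1 - Al)" using Al by (intro key) auto
    then show ?thesis by (simp add: n_def Al_def)
  qed
qed

text \<open>Admissibility of the digit sequence, in the form needed for \<open>Q\<^sub>n \<le> q\<^sub>n\<close>: the second conjunct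
  is what the step to a maximal digit \<open>b\<^sub>n = a\<^sub>n - 1\<close> requires.\<close>

lemma Q_le_aux:
  "Q (Suc n) \<le> q (Suc n) \<and> (w (Suc (Suc n)) < 0 \<longrightarrow> Q (Suc n) \<le> q (Suc n) - q n)"
proof (induction n)
  case 0
  have "dav_coeff \<alpha> \<beta> (Suc 0) < ncf_coeff \<alpha> (Suc 0)" by (rule dav_coeff_less) simp
  then show ?case using not_last_digit_if_w_neg[of "Suc 0"]
    by (auto simp: Q_Suc Q_0 simp del: dav_rem.simps ncf_rem.simps)
next
  case (Suc n)
  let ?k = "Suc (Suc n)"
  have c: "dav_coeff \<alpha> \<beta> ?k \<le> ncf_coeff \<alpha> ?k - 1" using dav_coeff_less[of ?k] by simp
  have qk: "q ?k - Q ?k = (a ?k - b ?k) * q (Suc n) - q n - Q (Suc n)"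
    unfolding q_rec Q_Suc[of "Suc n"] by (simp add: algebra_simps)
  have mon: "x * q (Suc n) \<le> (a ?k - b ?k) * q (Suc n)" if "x \<le> a ?k - b ?k" for x
    using that q_ge_1[of "Suc n"] by (intro mult_right_mono) auto
  have IH: "Q (Suc n) \<le> q (Suc n)" "w ?k < 0 \<Longrightarrow> Q (Suc n) \<le> q (Suc n) - q n"
    using Suc by auto
  have qq: "q n \<le> q (Suc n)" "0 \<le> q (Suc n)"
    using q_Suc_ge[of n] q_ge_1[of "Suc n"] by linarith+
  have "Q ?k \<le> q ?k"
  proof (cases "dav_coeff \<alpha> \<beta> ?k = ncf_coeff \<alpha> ?k - 1")
    case True
    then have "a ?k - b ?k = 1" by simp
    then show ?thesis using qk IH(2)[OF w_neg_if_last_digit[OF _ True]] by simp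
  next
    case False
    then have "2 \<le> a ?k - b ?k" using c by linarith
    then show ?thesis using mon[of 2] qk IH(1) qq by linarith
  qed
  moreover have "Q ?k \<le> q ?k - q (Suc n)" if w: "w (Suc ?k) < 0"
  proof (cases "dav_coeff \<alpha> \<beta> ?k = ncf_coeff \<alpha> ?k - 2")
    case True
    then have ab: "a ?k - b ?k = 2" by simp
    \<comment> \<open>The digit \<open>a - 2\<close> passes the negative sign back one index, so the
      stronger half of the induction hypothesis applies.\<close>
    have "w ?k = A ?k * w (Suc ?k)" using w_rec[of ?k] ab by simp
    also have "\<dots> < 0" using w rem_pos[of ?k] by (intro mult_pos_neg) auto
    finally have "w ?k < 0" .
    then show ?thesis using qk IH(2) ab by simp
  next
    case False
    then have "3 \<le> a ?k - b ?k" using not_last_digit_if_w_neg[of ?k] w by simp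
    then show ?thesis using mon[of 3] qk IH(1) qq by linarith
  qed
  ultimately show ?case by blast
qed

lemma Q_le: "Q n \<le> q n"
  by (cases n) (use Q_le_aux in \<open>auto simp: Q_0\<close>)

end


subsection \<open>Bounded partial quotients\<close>

locale ncf_bdd = ncf +
  fixes M :: int and N :: nat
  assumes coeff_le: "i \<ge> 1 \<Longrightarrow> ncf_coeff \<alpha> i \<le> M"
    and large_coeff: "i \<ge> 1 \<Longrightarrow> \<exists>j<N. 3 \<le> ncf_coeff \<alpha> (i + j)"
begin

abbreviation "R \<equiv> real N / (real N + 1)"
abbreviation "m \<equiv> real_of_int M"

lemma N_ge_1: "N \<ge> 1"
  using large_coeff[of 1] by auto

lemma M_ge_3: "M \<ge> 3"
proof -
  obtain j where "3 \<le> ncf_coeff \<alpha> (1 + j)" using large_coeff[of 1] by auto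
  then show ?thesis using coeff_le[of "1 + j"] by linarith
qed

lemma R_ge_half: "1 / 2 \<le> R" and R_less_1: "R < 1"
  using N_ge_1 by (simp_all add: field_simps)

lemma rem_ge: "i \<ge> 1 \<Longrightarrow> 1 / m \<le> A i"
proof -
  assume i: "i \<ge> 1"
  have "1 = A i * (a i - A (Suc i))" using rem_mult[OF i] by simp
  also have "\<dots> \<le> A i * m"
    using rem_pos[OF i] rem_pos[of "Suc i"] coeff_le[OF i] by (intro mult_left_mono) auto
  finally show ?thesis using M_ge_3 by (simp add: field_simps)
qed

text \<open>A coefficient at least 3 gives \<open>A i < 1 / 2\<close>, and each preceding 2 acts by
  x -> 1 / (2 - x), which sends (l + 1) / (l + 2) to (l + 2) / (l + 3).\<close>

lemma rem_le_aux:
  assumes "i \<ge> 1" and "\<exists>j\<le>l. 3 \<le> ncf_coeff \<alpha> (i + j)"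
  shows "A i * (real l + 2) \<le> real l + 1"
  using assms
proof (induction l arbitrary: i)
  case 0
  have "A i * 2 \<le> A i * (a i - A (Suc i))"
    using 0 rem_pos[of i] rem_less_1[of "Suc i"] by (intro mult_left_mono) auto
  then show ?case using rem_mult[of i] 0 by simp
next
  case (Suc l)
  show ?case
  proof (cases "3 \<le> ncf_coeff \<alpha> i")
    case True
    have "A i * 2 \<le> A i * (a i - A (Suc i))"
      using True Suc rem_pos[of i] rem_less_1[of "Suc i"] by (intro mult_left_mono) auto
    then have "A i * 2 \<le> 1" using rem_mult[of i] Suc by simp
    then have "A i * 2 * (real l + 3) \<le> 1 * (real l + 3)" by (intro mult_right_mono) auto
    then show ?thesis by (simp add: algebra_simps)
  next
    case False
    then have a2: "a i = 2" using coeff_ge_2[of i] Suc by simp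
    obtain j where "j \<le> Suc l" "3 \<le> ncf_coeff \<alpha> (i + j)" using Suc by blast
    then have "\<exists>j\<le>l. 3 \<le> ncf_coeff \<alpha> (Suc i + j)" using False by (cases j) auto
    then have "A (Suc i) * (real l + 2) \<le> real l + 1" by (intro Suc.IH) auto
    then have "real l + 3 \<le> (2 - A (Suc i)) * (real l + 2)" by (simp add: algebra_simps)
    then have "A i * (real l + 3) \<le> A i * ((2 - A (Suc i)) * (real l + 2))"
      using rem_pos[of i] Suc by (intro mult_left_mono) auto
    also have "\<dots> = real l + 2"
      using rem_mult[of i] Suc a2 by (simp flip: mult.assoc del: ncf_rem.simps)
    finally show ?thesis by (simp add: algebra_simps)
  qed
qed

lemma rem_le: "i \<ge> 1 \<Longrightarrow> A i \<le> R"
proof -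
  assume i: "i \<ge> 1"
  have "\<exists>j\<le>N - 1. 3 \<le> ncf_coeff \<alpha> (i + j)" 
    using large_coeff[OF i] by (metis Suc_pred' less_Suc_eq_le N_ge_1 less_le_trans zero_less_one)
  from rem_le_aux[OF i this] show ?thesis using N_ge_1 by (simp add: field_simps of_nat_diff)
qed

lemma q_double: "3 \<le> ncf_coeff \<alpha> (Suc n) \<Longrightarrow> 2 * q n \<le> q (Suc n)"
proof (cases n)
  case (Suc n')
  assume "3 \<le> ncf_coeff \<alpha> (Suc n)"
  then have "3 * q n \<le> a (Suc n) * q n" using q_ge_1[of n] by (intro mult_right_mono) auto
  then show ?thesis using q_rec[of n'] q_Suc_ge[of n'] Suc by simp
qed simp

lemma q_Suc_le: "q (Suc n) \<le> m * q n"
proof -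
  have "q (Suc n) \<le> a (Suc n) * q n"
  proof (cases n)
    case (Suc n')
    then show ?thesis using q_rec[of n'] q_ge_1[of n'] by simp
  qed simp
  also have "\<dots> \<le> m * q n" using coeff_le[of "Suc n"] q_ge_1[of n] by (intro mult_right_mono) auto
  finally show ?thesis .
qed

text \<open>Mirror image of \<open>rem_le_aux\<close>, reading the coefficients backwards:
  \<open>q n / q (Suc n)\<close> plays the role of \<open>A\<close>. The condition
  \<open>l \<le> n\<close> keeps the indices positive.\<close>

lemma q_ratio_aux:
  assumes "l \<le> n" and "\<exists>j\<le>l. 3 \<le> ncf_coeff \<alpha> (Suc n - j)"
  shows "(real l + 2) * q n \<le> (real l + 1) * q (Suc n)"
  using assms
proof (induction l arbitrary: n)
  case 0
  then show ?case using q_double[of n] by simp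
next
  case (Suc l)
  show ?case
  proof (cases "3 \<le> ncf_coeff \<alpha> (Suc n)")
    case True
    then have "(real l + 2) * (2 * q n) \<le> (real l + 2) * q (Suc n)"
      using q_double[of n] by (intro mult_left_mono) auto
    moreover have "0 \<le> (real l + 1) * q n" using q_ge_1[of n] by (intro mult_nonneg_nonneg) auto
    ultimately show ?thesis by (simp add: algebra_simps)
  next
    case False
    obtain n' where n: "n = Suc n'" using Suc by (cases n) auto
    have a2: "a (Suc n) = 2" using False coeff_ge_2[of "Suc n"] by simp
    obtain j where "j \<le> Suc l" "3 \<le> ncf_coeff \<alpha> (Suc n - j)" using Suc by blast
    then have "\<exists>j\<le>l. 3 \<le> ncf_coeff \<alpha> (Suc n' - j)" using False n by (cases j) auto
    then have "(real l + 2) * q n' \<le> (real l + 1) * q n" unfolding n using Suc n by (intro Suc.IH) auto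
    moreover have e: "q (Suc n) = 2 * q n - q n'" using q_rec[of n'] a2 n by simp
    ultimately show ?thesis unfolding e by (simp add: algebra_simps)
  qed
qed

lemma q_ratio:
  assumes "N \<le> Suc n"
  shows "q n \<le> R * q (Suc n)"
proof -
  have "1 \<le> Suc (Suc n) - N" using assms by simp
  then obtain j where j: "j < N" "3 \<le> ncf_coeff \<alpha> (Suc (Suc n) - N + j)"
    using large_coeff by blast
  \<comment> \<open>The window of length \<open>N\<close> ending at \<open>Suc n\<close> is
    traversed in reverse.\<close>
  have "Suc n - (N - 1 - j) = Suc (Suc n) - N + j" using j(1) assms by simp
  then have "\<exists>j\<le>N - 1. 3 \<le> ncf_coeff \<alpha> (Suc n - j)"
    using j by (intro exI[of _ "N - 1 - j"]) auto
  from q_ratio_aux[OF _ this] show ?thesis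
    using N_ge_1 assms by (simp add: field_simps of_nat_diff)
qed

text \<open>In \<open>det\<close> the subtracted product is at most \<open>R\<^sup>2\<close> times
  the other one.\<close>

lemma q_mult_D_le:
  assumes "N \<le> n"
  shows "q n * D n \<le> 1 / (1 - R\<^sup>2)"
proof -
  obtain k where k: "n = Suc k" using assms N_ge_1 by (cases n) auto
  have "D n * A (Suc n) \<le> D n * R"
    using rem_le[of "Suc n"] D_pos[of n] by (intro mult_left_mono) auto
  then have "D (Suc n) \<le> R * D n" by (simp only: D_Suc mult.commute)
  then have "q k * D (Suc n) \<le> (R * q n) * (R * D n)"
    using q_ratio[of k] assms k D_pos[of "Suc n"] q_ge_1[of n] by (intro mult_mono) auto
  then have "q n * D n * (1 - R\<^sup>2) \<le> 1"
    using det[of k] unfolding k by (simp add: algebra_simps power2_eq_square)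
  moreover have "0 < 1 - R\<^sup>2" using R_less_1 R_ge_half by (simp add: power_less_one_iff abs_square_less_1)
  ultimately show ?thesis by (simp add: field_simps)
qed

text \<open>In \<open>det\<close> the subtracted product is at least \<open>1 / m\<^sup>2\<close>
  times the other one, \<open>X\<close>, so \<open>X \<ge> m\<^sup>2 / (m\<^sup>2 - 1)\<close>;
  passing to the next \<open>D\<close> costs one more factor \<open>m\<close>.\<close>

lemma q_mult_D_Suc_ge: "m / (m\<^sup>2 - 1) \<le> q (Suc n) * D (Suc (Suc n))"
proof -
  define X where "X = q (Suc n) * D (Suc n)"
  have X1: "X \<ge> 1" unfolding X_def by (rule q_mult_D_ge_1)
  have m3: "3 \<le> m" using M_ge_3 by simp
  have m2: "0 < m\<^sup>2 - 1" using m3 by simp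
  have "q (Suc n) / m * (D (Suc n) * (1 / m)) \<le> q n * D (Suc (Suc n))"
    unfolding D_Suc[of "Suc n"] using q_Suc_le[of n] rem_ge[of "Suc (Suc n)"] m3 D_pos[of "Suc n"] q_ge_1[of n]
    by (intro mult_mono) (auto simp: field_simps)
  then have "X / m\<^sup>2 \<le> X - 1" using det[of n] by (simp add: X_def power2_eq_square)
  then have "m\<^sup>2 / (m\<^sup>2 - 1) \<le> X" using m3 m2 by (simp add: field_simps)
  then have "m\<^sup>2 / (m\<^sup>2 - 1) * (1 / m) \<le> X * A (Suc (Suc n))"
    using m3 m2 rem_ge[of "Suc (Suc n)"] X1 by (intro mult_mono) auto
  then show ?thesis using m3 by (simp add: X_def D_Suc[of "Suc n"] power2_eq_square mult.assoc)
qed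

lemma D_ge: "D n \<le> m ^ l * D (n + l)"
proof (induction l)
  case (Suc l)
  have "1 \<le> m * A (Suc (n + l))" 
    using rem_ge[of "Suc (n + l)"] M_ge_3 by (simp add: field_simps)
  then have "m ^ l * D (n + l) * 1 \<le> m ^ l * D (n + l) * (m * A (Suc (n + l)))"
    using M_ge_3 D_pos[of "n + l"] by (intro mult_left_mono) auto
  then show ?case using Suc by (simp add: D_Suc mult_ac)
qed simp

lemma D_le: "D (n + l) \<le> R ^ l * D n"
proof (induction l)
  case (Suc l)
  have "D (n + l) * A (Suc (n + l)) \<le> (R ^ l * D n) * R"
    using Suc rem_le[of "Suc (n + l)"] rem_pos[of "Suc (n + l)"] D_pos[of n]
    by (intro mult_mono) auto
  then show ?case by (simp add: D_Suc mult_ac)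
qed simp

end

section \<open>Uniform lower bounds away from maximal digit blocks\<close>

locale davenport_bdd = davenport + ncf_bdd +
  fixes s :: nat
  assumes s_pos: "s > 0"
    and no_max_block: "\<not> (\<exists>j\<ge>1. dav_coeff \<alpha> \<beta> j = ncf_coeff \<alpha> j - 1 \<and>
      (\<forall>t\<in>{j<..<j + N + s}. dav_coeff \<alpha> \<beta> t = ncf_coeff \<alpha> t - 2))"
begin

lemma w_gt: "i \<ge> 1 \<Longrightarrow> 1 - R \<le> 1 + w i"
  using rem_le[of i] dav_rem_less_1[of i] by linarith

lemma step_ge:
  assumes "i \<ge> 1" and "1 \<le> c"
  shows "(1 - R) / m \<le> A i * (c + w (Suc i))"
proof -
  have "1 / m * (1 - R) \<le> A i * (c + w (Suc i))"
    using rem_ge[of i] rem_pos[of i] w_gt[of "Suc i"] assms R_less_1 by (intro mult_mono) auto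
  then show ?thesis by simp
qed

text \<open>Each digit \<open>a - 2\<close> costs a factor of at most \<open>m\<close>. The first
  other digit is below \<open>a - 2\<close>, because \<open>a - 1\<close> would make
  \<open>w\<close> negative, and there \<open>step_ge\<close> applies.\<close>

lemma w_ge:
  assumes "i \<ge> 1" and "w i > 0" and "\<exists>t<l. dav_coeff \<alpha> \<beta> (i + t) \<noteq> ncf_coeff \<alpha> (i + t) - 2"
  shows "(1 - R) / m ^ l \<le> w i"
  using assms
proof (induction l arbitrary: i)
  case (Suc l)
  have m3: "m \<ge> 3" using M_ge_3 by simp
  show ?case
  proof (cases "dav_coeff \<alpha> \<beta> i = ncf_coeff \<alpha> i - 2")
    case True
    then have wi: "w i = A i * w (Suc i)" using w_rec[of i] Suc by simp
    then have wp: "w (Suc i) > 0" using Suc rem_pos[of i] by (simp add: zero_less_mult_iff)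
    obtain t where "t < Suc l" "dav_coeff \<alpha> \<beta> (i + t) \<noteq> ncf_coeff \<alpha> (i + t) - 2"
      using Suc by blast
    then have "\<exists>t<l. dav_coeff \<alpha> \<beta> (Suc i + t) \<noteq> ncf_coeff \<alpha> (Suc i + t) - 2"
      using True by (cases t) auto
    then have "(1 - R) / m ^ l \<le> w (Suc i)" using wp by (intro Suc.IH) auto
    then have "1 / m * ((1 - R) / m ^ l) \<le> A i * w (Suc i)"
      using rem_ge[of i] rem_pos[of i] Suc R_less_1 m3 by (intro mult_mono) auto
    then show ?thesis using wi by simp
  next
    case False
    have "dav_coeff \<alpha> \<beta> i \<noteq> ncf_coeff \<alpha> i - 1" using w_neg_if_last_digit[of i] Suc by auto
    then have "1 \<le> a i - 2 - b i" using False dav_coeff_less[of i] Suc by linarith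
    then have "(1 - R) / m \<le> w i" using w_rec[of i] step_ge[of i "a i - 2 - b i"] Suc by simp
    moreover have "(1 - R) / m ^ Suc l \<le> (1 - R) / m"
      using m3 R_less_1 self_le_power[of m "Suc l"] by (intro divide_left_mono) auto
    ultimately show ?thesis by linarith
  qed
qed simp

text \<open>Only the digit \<open>a i - 1\<close> is critical: then
  \<open>1 - B i = A i * w (Suc i)\<close>, and \<open>no_max_block\<close> limits the run of digits
  \<open>a - 2\<close> that follows, as \<open>w_ge\<close> requires.\<close>

lemma one_minus_dav_rem_ge:
  assumes "i \<ge> 1"
  shows "(1 - R) / m ^ (N + s) \<le> 1 - B i"
proof (cases "dav_coeff \<alpha> \<beta> i = ncf_coeff \<alpha> i - 1")
  case True
  have m3: "m \<ge> 3" using M_ge_3 by simp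
  have e: "1 - B i = A i * w (Suc i)" using one_minus_dav_rem[of i] assms True by simp
  have "0 < A i * w (Suc i)" using e dav_rem_less_1[of i] assms by simp
  then have wp: "0 < w (Suc i)" using rem_pos[of i] assms by (simp only: zero_less_mult_iff) auto
  obtain t where "t \<in> {i<..<i + N + s}" "dav_coeff \<alpha> \<beta> t \<noteq> ncf_coeff \<alpha> t - 2"
    using no_max_block True assms by blast
  then have "\<exists>t'<N + s - 1. dav_coeff \<alpha> \<beta> (Suc i + t') \<noteq> ncf_coeff \<alpha> (Suc i + t') - 2"
    by (intro exI[of _ "t - Suc i"]) auto
  then have "(1 - R) / m ^ (N + s - 1) \<le> w (Suc i)" using wp by (intro w_ge) auto
  then have "1 / m * ((1 - R) / m ^ (N + s - 1)) \<le> A i * w (Suc i)"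
    using rem_ge[of i] rem_pos[of i] assms R_less_1 m3 by (intro mult_mono) auto
  moreover have "m ^ (N + s) = m * m ^ (N + s - 1)"
    using s_pos by (simp flip: power_Suc)
  ultimately show ?thesis unfolding e by simp
next
  case False
  have m3: "m \<ge> 3" using M_ge_3 by simp
  have "1 \<le> a i - 1 - b i" using False dav_coeff_less[of i] assms by linarith
  then have "(1 - R) / m \<le> 1 - B i"
    using one_minus_dav_rem[of i] step_ge[of i "a i - 1 - b i"] assms by simp
  moreover have "(1 - R) / m ^ (N + s) \<le> (1 - R) / m"
    using m3 R_less_1 self_le_power[of m "N + s"] s_pos by (intro divide_left_mono) auto
  ultimately show ?thesis by linarith
qed

text \<open>The product of the bounds in \<open>q_mult_D_Suc_ge\<close> and
  \<open>one_minus_dav_rem_ge\<close>.\<close>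

definition "K = (1 - R) * m / (m ^ (N + s) * (m\<^sup>2 - 1))"

text \<open>Makes the same constant serve in \<open>lam_between\<close>; it rests on
  \<open>1 - R \<le> 1 / 2\<close>.\<close>

lemma K_le: "K \<le> 1 / m ^ (N + s + 1)"
proof -
  have m3: "m \<ge> 3" using M_ge_3 by simp
  have "(1 - R) * m\<^sup>2 \<le> 1 / 2 * m\<^sup>2" using R_ge_half by (intro mult_right_mono) auto
  moreover have "3 * 3 \<le> m\<^sup>2" unfolding power2_eq_square using m3 by (intro mult_mono) auto
  ultimately have "(1 - R) * m\<^sup>2 \<le> m\<^sup>2 - 1" "0 < m\<^sup>2 - 1" by linarith+
  then have "(1 - R) * m\<^sup>2 / (m\<^sup>2 - 1) \<le> 1" by simp
  then have "(1 - R) * m\<^sup>2 / (m\<^sup>2 - 1) / m ^ (N + s + 1) \<le> 1 / m ^ (N + s + 1)"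
    using m3 by (intro divide_right_mono) auto
  moreover have "K = (1 - R) * m\<^sup>2 / (m\<^sup>2 - 1) / m ^ (N + s + 1)"
    using m3 by (simp add: K_def power2_eq_square del: times_divide_eq_left)
  ultimately show ?thesis by simp
qed

text \<open>\<open>product_lower_bound\<close> is applied at \<open>Suc n\<close>, so that
  \<open>q_mult_D_Suc_ge\<close> covers the factor in its last two alternatives.\<close>

lemma product_ge:
  fixes j p :: int
  assumes lower: "Q (Suc (Suc n)) + q (Suc n) \<le> of_int j"
    and upper: "of_int j < Q (Suc (Suc (Suc n))) + q (Suc (Suc n))"
  defines "P \<equiv> of_int j * \<bar>of_int j * \<alpha> - of_int p - \<beta>\<bar>"
  shows "P \<ge> lam (Suc (Suc n)) \<or> P \<ge> lam (Suc (Suc (Suc n))) \<or> P \<ge> K"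
proof -
  have m3: "m \<ge> 3" using M_ge_3 by simp
  have mN: "1 \<le> m ^ (N + s)" using m3 by (simp add: one_le_power)
  have m2: "0 < m\<^sup>2 - 1" using m3 by simp
  have K: "K \<le> q (Suc n) * D (Suc (Suc n)) * y" if "(1 - R) / m ^ (N + s) \<le> y" for y
  proof -
    have "m / (m\<^sup>2 - 1) * ((1 - R) / m ^ (N + s)) \<le> q (Suc n) * D (Suc (Suc n)) * y"
      using that q_mult_D_Suc_ge[of n] m3 m2 R_less_1 q_ge_1[of "Suc n"] D_pos[of "Suc (Suc n)"]
      by (intro mult_mono) auto
    then show ?thesis by (simp add: K_def mult_ac)
  qed
  have "(1 - R) / m ^ (N + s) \<le> (1 - R) / 1"
    using mN R_less_1 by (intro divide_left_mono) auto
  also have "\<dots> \<le> 1 - A (Suc (Suc (Suc n)))"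
    using rem_le[of "Suc (Suc (Suc n))"] by simp
  finally have "(1 - R) / m ^ (N + s) \<le> 1 - A (Suc (Suc (Suc n)))" .
  with K one_minus_dav_rem_ge[of "Suc (Suc (Suc n))"] product_lower_bound[OF lower upper, of p]
  show ?thesis unfolding P_def by fastforce
qed


section \<open>Behaviour of \<open>Q\<close> and \<open>lam\<close> around zero digits\<close>

lemma infinitely_many_digits:
  assumes "\<not> (\<exists>n m :: int. \<beta> = of_int n * \<alpha> + of_int m)"
  shows "\<exists>j>n. dav_coeff \<alpha> \<beta> j \<noteq> 0"
proof (rule ccontr)
  assume "\<not> ?thesis"
  then have z: "dav_coeff \<alpha> \<beta> j = 0" if "n < j" for j using that by blast
  \<comment> \<open>Without further digits the tail is constant yet bounded by a geometric sequence,
    so it vanishes and \<beta> has the excluded form.\<close>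
  have "D n * B (Suc n) \<le> R ^ l * D n" for l
  proof -
    have "D n * B (Suc n) = D (n + l) * B (Suc (n + l))"
      using zero_block(2)[of n "n + l"] z by simp
    also have "\<dots> \<le> D (n + l) * 1"
      using dav_rem_less_1[of "Suc (n + l)"] D_pos[of "n + l"] by (intro mult_left_mono) auto
    also have "\<dots> \<le> R ^ l * D n" using D_le[of n l] by simp
    finally show ?thesis .
  qed
  moreover have "(\<lambda>l. R ^ l * D n) \<longlonglongrightarrow> 0 * D n"
    using R_less_1 by (intro tendsto_mult tendsto_const LIMSEQ_power_zero) auto
  ultimately have "D n * B (Suc n) \<le> 0 * D n" by (intro LIMSEQ_le_const) auto
  then have B0: "B (Suc n) = 0"
    using D_pos[of n] dav_rem_nonneg[of "Suc n"] by (simp add: mult_le_0_iff del: dav_rem.simps)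
  obtain p :: int where "Q n * \<alpha> - of_int p - \<beta> = - D n * B (Suc n)" using Q_approx by blast
  then have "\<beta> = of_int (dav_Q \<alpha> \<beta> n) * \<alpha> + of_int (- p)" using B0 by simp
  then show False using assms by blast
qed

text \<open>Allows the limit inferior over all integers to be tested along the values
  \<open>Q n\<close>.\<close>

lemma filterlim_dav_Q:
  assumes "\<not> (\<exists>n m :: int. \<beta> = of_int n * \<alpha> + of_int m)"
  shows "filterlim (\<lambda>n. nat (dav_Q \<alpha> \<beta> n)) at_top sequentially"
  unfolding filterlim_at_top eventually_sequentially
proof
  fix c :: nat
  obtain j where j: "j > c" "dav_coeff \<alpha> \<beta> j \<noteq> 0" using infinitely_many_digits[OF assms] by blast
  obtain j' where j': "j = Suc j'" using j by (cases j) auto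
  have "c \<le> nat (dav_Q \<alpha> \<beta> n)" if "j \<le> n" for n
  proof -
    have "real c \<le> q j'" using q_ge[of j'] j j' by linarith
    also have "\<dots> \<le> Q j" using Q_ge[of j'] j j' by simp
    also have "\<dots> \<le> Q n" by (rule Q_mono[OF that])
    finally show ?thesis by linarith
  qed
  then show "\<exists>N. \<forall>n\<ge>N. c \<le> nat (dav_Q \<alpha> \<beta> n)" by blast
qed

text \<open>The zeros shrink the tail to at most \<open>R ^ r * D l\<close>; then
  \<open>Q_le\<close> and \<open>q_mult_D_le\<close> bound the product.\<close>

lemma lam_le:
  assumes "N \<le> l" and "\<And>j. l < j \<Longrightarrow> j \<le> l + r \<Longrightarrow> dav_coeff \<alpha> \<beta> j = 0"
  shows "lam l \<le> R ^ r / (1 - R\<^sup>2)"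
proof -
  have "D l * B (Suc l) = D (l + r) * B (Suc (l + r))"
    using zero_block(2)[of l "l + r"] assms by simp
  also have "\<dots> \<le> D (l + r) * 1"
    using dav_rem_less_1[of "Suc (l + r)"] D_pos[of "l + r"] by (intro mult_left_mono) auto
  also have "\<dots> \<le> R ^ r * D l" using D_le[of l r] by simp
  finally have "D l * B (Suc l) \<le> R ^ r * D l" .
  moreover have "0 \<le> D l * B (Suc l)"
    using D_pos[of l] dav_rem_nonneg[of "Suc l"] by (intro mult_nonneg_nonneg) auto
  ultimately have "Q l * (D l * B (Suc l)) \<le> q l * (R ^ r * D l)"
    using Q_le[of l] q_ge_1[of l] by - (rule mult_mono, auto)
  also have "\<dots> = R ^ r * (q l * D l)" by simp
  also have "\<dots> \<le> R ^ r * (1 / (1 - R\<^sup>2))"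
    using q_mult_D_le[OF assms(1)] by (intro mult_left_mono) auto
  finally show ?thesis by (simp add: lam_eq mult.assoc)
qed

text \<open>If nonzero digits occur on both sides of \<open>n\<close>, let
  \<open>j \<le> n < j'\<close> be the nearest. Then \<open>Q n \<ge> q (j - 1)\<close> and the tail
  is at least \<open>D j'\<close>, which is comparable to \<open>D (j - 1)\<close> because the gap
  is short; \<open>q_mult_D_ge_1\<close> finishes.\<close>

lemma lam_between:
  assumes zeros: "\<And>j. l < j \<Longrightarrow> j \<le> l + r \<Longrightarrow> dav_coeff \<alpha> \<beta> j = 0"
    and no_block: "\<not> (\<exists>j. {j..<j + N + s} \<subseteq> {l + r<..<u} \<and>
      (\<forall>t\<in>{j..<j + N + s}. dav_coeff \<alpha> \<beta> t = 0))"
    and n: "l \<le> n" "n \<le> u"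
  shows "lam n = lam l \<or> lam n = lam u \<or> K \<le> lam n"
proof (cases "(\<forall>j. l < j \<and> j \<le> n \<longrightarrow> dav_coeff \<alpha> \<beta> j = 0) \<or>
    (\<forall>j. n < j \<and> j \<le> u \<longrightarrow> dav_coeff \<alpha> \<beta> j = 0)")
  case True
  then show ?thesis using zero_block_lam[OF n(1)] zero_block_lam[OF n(2)] by metis
next
  case False
  let ?S = "{j. l < j \<and> j \<le> n \<and> dav_coeff \<alpha> \<beta> j \<noteq> 0}"
  let ?T = "{j. n < j \<and> j \<le> u \<and> dav_coeff \<alpha> \<beta> j \<noteq> 0}"
  have S: "finite ?S" "?S \<noteq> {}" and T: "finite ?T" "?T \<noteq> {}" using False by auto
  define j where "j = Max ?S"
  define j' where "j' = Min ?T"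
  have j: "l < j" "j \<le> n" "dav_coeff \<alpha> \<beta> j \<noteq> 0" using Max_in[OF S] by (auto simp: j_def)
  have j': "n < j'" "j' \<le> u" "dav_coeff \<alpha> \<beta> j' \<noteq> 0" using Min_in[OF T] by (auto simp: j'_def)
  have z1: "dav_coeff \<alpha> \<beta> t = 0" if "j < t" "t \<le> n" for t
    using Max_ge[OF S(1), of t] that j by (auto simp: j_def[symmetric])
  have z2: "dav_coeff \<alpha> \<beta> t = 0" if "n < t" "t < j'" for t
    using Min_le[OF T(1), of t] that j' by (auto simp: j'_def[symmetric])
  have z: "dav_coeff \<alpha> \<beta> t = 0" if "j < t" "t < j'" for t
    using z1[of t] z2[of t] that by linarith
  have "l + r < j" using zeros[of j] j by (meson not_le)
  \<comment> \<open>A longer gap would contain \<open>N + s\<close> zeros starting at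
    \<open>Suc j\<close> and ending before \<open>j' \<le> u\<close>.\<close>
  have gap: "j' \<le> j + N + s"
  proof (rule ccontr)
    assume "\<not> ?thesis"
    then have "{Suc j..<Suc j + N + s} \<subseteq> {l + r<..<u} \<and>
        (\<forall>t\<in>{Suc j..<Suc j + N + s}. dav_coeff \<alpha> \<beta> t = 0)"
      using \<open>l + r < j\<close> j'(2) z by auto
    then show False using no_block by blast
  qed
  obtain i i' where i: "j = Suc i" and i': "j' = Suc i'" using j j' by (cases j; cases j') auto
  define d where "d = j' - i"
  have d: "j' = i + d" "d \<le> N + s + 1" using gap j j' i by (auto simp: d_def)
  have m3: "m \<ge> 3" using M_ge_3 by simp
  have "1 \<le> q i * D i" by (rule q_mult_D_ge_1)
  also have "\<dots> \<le> q i * (m ^ d * D j')"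
    unfolding d(1) using D_ge[of i d] q_ge_1[of i] by (intro mult_left_mono) auto
  also have "\<dots> \<le> q i * (m ^ (N + s + 1) * D j')"
    using d m3 q_ge_1[of i] D_pos[of j'] by (intro mult_left_mono mult_right_mono power_increasing) auto
  finally have "1 / m ^ (N + s + 1) \<le> q i * D j'" using m3 by (simp add: field_simps)
  moreover have "q i * D j' \<le> Q n * (D n * B (Suc n))"
  proof (intro mult_mono)
    have "q i \<le> Q j" using Q_ge[of i] j i by simp
    also have "\<dots> \<le> Q n" by (rule Q_mono[OF j(2)])
    finally show "q i \<le> Q n" .
    have "D n * B (Suc n) = D i' * B (Suc i')"
      using zero_block(2)[of n i'] z2 j' i' by simp
    also have "\<dots> = D j' * (b j' + B (Suc j'))" using D_mult_dav_rem[of i'] i' by simp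
    also have "D j' * 1 \<le> D j' * (b j' + B (Suc j'))"
    proof (rule mult_left_mono)
      have "1 \<le> b j'" using j'(3) dav_coeff_nonneg[of j'] i' by simp
      then show "1 \<le> b j' + B (Suc j')" using dav_rem_nonneg[of "Suc j'"] by simp
    qed (use D_pos[of j'] in simp)
    ultimately show "D j' \<le> D n * B (Suc n)" by simp
  qed (use Q_nonneg[of n] D_pos[of j'] in auto)
  ultimately show ?thesis using K_le by (simp add: lam_eq mult.assoc)
qed

text \<open>The threshold in the definition of \<open>ncf_L\<close>.\<close>

abbreviation "c \<equiv> (1 - R) * (1 - R\<^sup>2) / (m ^ N * (m\<^sup>2 - 1))"

lemma c_pos: "0 < c" and c_le: "c \<le> 1 / m"
proof -
  have m3: "m \<ge> 3" using M_ge_3 by simp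
  have m2: "1 \<le> m\<^sup>2 - 1" using mult_mono[of 3 m 3 m] m3 by (simp add: power2_eq_square)
  have R2: "0 < 1 - R\<^sup>2" "1 - R\<^sup>2 \<le> 1"
    using R_less_1 R_ge_half by (simp_all add: abs_square_less_1)
  have "m * 1 \<le> m ^ N * (m\<^sup>2 - 1)"
    using m3 m2 N_ge_1 by (intro mult_mono self_le_power) auto
  moreover have "(1 - R) * (1 - R\<^sup>2) \<le> 1 * 1" using R_less_1 R2 by (intro mult_mono) auto
  ultimately show "c \<le> 1 / m" using m3 by (intro frac_le) auto
  show "0 < c" using m3 m2 R2 R_less_1 by (intro divide_pos_pos mult_pos_pos) auto
qed

text \<open>All but one factor of \<open>c ^ s\<close> are weakened to \<open>1 / m\<close>; the
  remaining \<open>c\<close> supplies the factor \<open>1 - R\<^sup>2\<close> that cancels, and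
  exactly \<open>K\<close> is left.\<close>

lemma K_ge:
  assumes "x \<le> c ^ s"
  shows "x / (1 - R\<^sup>2) \<le> K"
proof -
  have m3: "m \<ge> 3" using M_ge_3 by simp
  have R2: "0 < 1 - R\<^sup>2" using R_less_1 R_ge_half by (simp_all add: abs_square_less_1)
  have "c * c ^ (s - 1) \<le> c * (1 / m) ^ (s - 1)"
    using c_pos c_le by (intro mult_left_mono power_mono) auto
  moreover have "c ^ s = c * c ^ (s - 1)" using s_pos by (simp only: power_minus_mult mult.commute[of c])
  ultimately have "x \<le> c * (1 / m) ^ (s - 1)" using assms by linarith
  then have "x / (1 - R\<^sup>2) \<le> c * (1 / m) ^ (s - 1) / (1 - R\<^sup>2)"
    using R2 by (intro divide_right_mono) auto
  also have "\<dots> = (1 - R) / (m ^ N * (m\<^sup>2 - 1)) * (1 / m) ^ (s - 1)"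
    using R2 by simp
  also have "(1 / m) ^ (s - 1) = m / m ^ s"
    using m3 s_pos by (cases s) (auto simp: power_one_over)
  also have "(1 - R) / (m ^ N * (m\<^sup>2 - 1)) * (m / m ^ s) = K"
    by (simp only: K_def power_add times_divide_times_eq mult_ac)
  finally show ?thesis .
qed

end

text \<open>A least integer exponent exists because negative exponents give powers at least 1 >
  \<open>c\<close>; the search reduces to the naturals.\<close>

lemma power_int_Least_le:
  fixes x c :: real
  assumes "0 < x" "x < 1" "0 < c" "c < 1"
  shows "x powi (LEAST l. x powi l \<le> c) \<le> c"
proof -
  obtain n where "x ^ n < c" using real_arch_pow_inv[OF assms(3,2)] by blast
  then have ex: "x ^ n \<le> c" by simp
  let ?n = "LEAST n. x ^ n \<le> c"
  have n: "x ^ ?n \<le> c" by (rule LeastI[of "\<lambda>n. x ^ n \<le> c", OF ex])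
  have "(LEAST l. x powi l \<le> c) = int ?n"
  proof (rule Least_equality)
    show "x powi int ?n \<le> c" using n by simp
    fix l :: int
    assume l: "x powi l \<le> c"
    have "0 \<le> l"
    proof (rule ccontr)
      assume "\<not> 0 \<le> l"
      then have "x powi 0 \<le> x powi l" using assms by (intro power_int_decreasing) auto
      then show False using l assms by simp
    qed
    then obtain k where k: "l = int k" by (metis nonneg_int_cases)
    then have "x ^ k \<le> c" using l by simp
    then show "int ?n \<le> l" using Least_le[of "\<lambda>n. x ^ n \<le> c" k] k by simp
  qed
  then show ?thesis using n by simp
qed

text \<open>Otherwise \<open>g n \<le> x\<close> would propagate from \<open>n0\<close> to
  \<open>n1\<close>. It locates an index between consecutive \<open>k i\<close> and an integer in
  one of the windows of \<open>product_ge\<close>.\<close>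

lemma bracket:
  fixes g :: "nat \<Rightarrow> 'a::linorder"
  assumes "g n0 \<le> x" and "n0 \<le> n1" and "x < g n1"
  shows "\<exists>n\<ge>n0. g n \<le> x \<and> x < g (Suc n)"
proof (rule ccontr)
  assume no: "\<not> ?thesis"
  have "g n \<le> x" if "n0 \<le> n" for n
    using that
  proof (induction rule: dec_induct)
    case (step k)
    then show ?case using no by (auto simp: not_less)
  qed (rule assms(1))
  then show False using assms by (meson leD)
qed

section \<open>From bounded coefficients to the equality of the limits inferior\<close>

lemma (in ncf) ncf_bdd_if_ncf_bounded:
  assumes "ncf_bounded \<alpha>"
  shows "ncf_bdd \<alpha> (ncf_M \<alpha>) (ncf_N \<alpha>)"
proof unfold_locales
  fix i :: nat
  assume i: "i \<ge> 1"
  show "ncf_coeff \<alpha> i \<le> ncf_M \<alpha>"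
    using assms i unfolding ncf_M_def ncf_bounded_def by (intro cSUP_upper) auto
  show "\<exists>j<ncf_N \<alpha>. 3 \<le> ncf_coeff \<alpha> (i + j)"
  proof (rule ccontr)
    assume "\<not> ?thesis"
    then have "ncf_coeff \<alpha> t = 2" if "t \<in> {i..<i + ncf_N \<alpha>}" for t
      using that coeff_ge_2[of t] i by (force dest: spec[of _ "t - i"])
    then have "ncf_N \<alpha> \<in> two_block_lengths \<alpha>" unfolding two_block_lengths_def using i by blast
    then have "ncf_N \<alpha> \<le> Sup (two_block_lengths \<alpha>)"
      using assms unfolding ncf_bounded_def by (intro cSup_upper) auto
    then show False by (simp add: ncf_N_def)
  qed
qed

theorem theorem6p2:
  fixes \<alpha> \<beta> :: real and r s :: nat and k :: "nat \<Rightarrow> nat"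
  assumes "0 < \<alpha>" and "\<alpha> < 1" and "\<alpha> \<notin> \<rat>"
    and "ncf_bounded \<alpha>"
    and "r > 0" and "s > 0" and "int r \<ge> int s * ncf_L \<alpha>"
    and "\<forall>i\<ge>1. k i > 0"
    and "strict_mono_on {1..} k"
    and "\<forall>i\<ge>1. k (i + 1) > k i + r"
    and "0 < \<beta>" and "\<beta> < 1"
    and "\<not> (\<exists>n m :: int. \<beta> = of_int n * \<alpha> + of_int m)"
    and "\<forall>i\<ge>1. \<forall>j\<in>{k i + 1..k i + r}. dav_coeff \<alpha> \<beta> j = 0"
    and "\<forall>i\<ge>1. \<not> (\<exists>j. {j..<j + ncf_N \<alpha> + s} \<subseteq> {k i + r<..<k (i + 1)} \<and>
                 (\<forall>t\<in>{j..<j + ncf_N \<alpha> + s}. dav_coeff \<alpha> \<beta> t = 0))"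
    and "\<not> (\<exists>j\<ge>1. dav_coeff \<alpha> \<beta> j = ncf_coeff \<alpha> j - 1 \<and>
                 (\<forall>t\<in>{j<..<j + ncf_N \<alpha> + s}. dav_coeff \<alpha> \<beta> t = ncf_coeff \<alpha> t - 2))"
  shows "M_plus \<alpha> \<beta> = liminf (\<lambda>i. ereal (dav_lambda \<alpha> \<beta> (k i)))"
proof -
  let ?f = "\<lambda>q::nat. ereal (real q * infdist (real q * \<alpha> - \<beta>) \<int>)"
  interpret davenport \<alpha> \<beta> using assms by unfold_locales auto
  interpret ncf_bdd \<alpha> "ncf_M \<alpha>" "ncf_N \<alpha>" by (rule ncf_bdd_if_ncf_bounded[OF assms(4)])
  interpret davenport_bdd \<alpha> \<beta> "ncf_M \<alpha>" "ncf_N \<alpha>" s using assms by unfold_locales auto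
  have zeros: "dav_coeff \<alpha> \<beta> j = 0" if "i \<ge> 1" "k i < j" "j \<le> k i + r" for i j
    using assms(14) that by auto
  have k_mono: "k i < k (Suc i)" if "i \<ge> 1" for i
    using assms(9) that by (auto simp: strict_mono_on_def)
  have k_ge: "i \<le> k i" for i
  proof (induction i)
    case (Suc i)
    \<comment> \<open>The value \<open>k 0\<close> is unconstrained, so the first step uses
      positivity of \<open>k 1\<close>.\<close>
    then show ?case using k_mono[of i] assms(8) by (cases "i = 0") (auto simp: Suc_le_eq)
  qed simp
  have k_lim: "filterlim k at_top sequentially"
    by (rule filterlim_at_top_mono[OF filterlim_ident]) (use k_ge in auto)
  \<comment> \<open>The integer from \<open>Q_approx\<close> bounds the distance to the nearest one
    from above.\<close>
  have upper: "?f (nat (dav_Q \<alpha> \<beta> n)) \<le> ereal (lam n)" for n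
  proof -
    obtain p :: int where p: "Q n * \<alpha> - of_int p - \<beta> = - D n * B (Suc n)"
      using Q_approx by blast
    have "infdist (Q n * \<alpha> - \<beta>) \<int> \<le> dist (Q n * \<alpha> - \<beta>) (of_int p)"
      by (intro infdist_le) auto
    also have "\<dots> = \<bar>Q n * \<alpha> - of_int p - \<beta>\<bar>" by (simp add: dist_real_def algebra_simps)
    also have "\<dots> = D n * B (Suc n)"
      unfolding p using D_pos[of n] dav_rem_nonneg[of "Suc n"] by (simp add: abs_mult del: dav_rem.simps)
    finally have "Q n * infdist (Q n * \<alpha> - \<beta>) \<int> \<le> Q n * (D n * B (Suc n))"
      using Q_nonneg[of n] by (intro mult_left_mono) auto
    then show ?thesis using Q_nonneg[of n] by (simp add: lam_eq mult.assoc del: dav_rem.simps)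
  qed
  \<comment> \<open>Taking \<open>i \<ge> ncf_N \<alpha>\<close> ensures
    \<open>k i \<ge> ncf_N \<alpha>\<close>, as \<open>lam_le\<close> demands.\<close>
  have lam_k_le: "lam (k i) \<le> K" if "i \<ge> 1" "ncf_N \<alpha> \<le> i" for i
  proof -
    have R: "0 < R" using R_ge_half by linarith
    have "c < 1"
    proof -
      have "1 / m < 1" using M_ge_3 by simp
      then show ?thesis using c_le by linarith
    qed
    then have L: "R powi ncf_L \<alpha> \<le> c"
      unfolding ncf_L_def ncf_R_def by (intro power_int_Least_le R R_less_1 c_pos)
    \<comment> \<open>Since \<open>R < 1\<close>, the condition on \<open>r\<close> turns
      \<open>R ^ r\<close> into at most \<open>c ^ s\<close>, the input of
      \<open>K_ge\<close>.\<close>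
    have "R ^ r = R powi int r" by simp
    also have "\<dots> \<le> R powi (ncf_L \<alpha> * int s)"
      using R R_less_1 assms(7) by (intro power_int_decreasing) (auto simp: mult.commute)
    also have "\<dots> = (R powi ncf_L \<alpha>) ^ s" by (simp only: power_int_mult power_int_of_nat)
    also have "\<dots> \<le> c ^ s" using L R by (intro power_mono) auto
    finally have "R ^ r / (1 - R\<^sup>2) \<le> K" by (rule K_ge)
    moreover have "lam (k i) \<le> R ^ r / (1 - R\<^sup>2)"
      using zeros[OF that(1)] k_ge[of i] that by (intro lam_le) auto
    ultimately show ?thesis by linarith
  qed
  show ?thesis
  proof (rule antisym)
    show "M_plus \<alpha> \<beta> \<le> liminf (\<lambda>i. ereal (lam (k i)))"
      unfolding le_Liminf_iff
    proof (intro allI impI)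
      fix y
      assume "y < M_plus \<alpha> \<beta>"
      then have "\<forall>\<^sub>F q in sequentially. y < ?f q"
        using le_Liminf_iff[of "M_plus \<alpha> \<beta>" sequentially ?f] unfolding M_plus_def by blast
      moreover have "filterlim (\<lambda>i. nat (dav_Q \<alpha> \<beta> (k i))) at_top sequentially"
        by (rule filterlim_compose[OF filterlim_dav_Q[OF assms(13)] k_lim])
      ultimately have "\<forall>\<^sub>F i in sequentially. y < ?f (nat (dav_Q \<alpha> \<beta> (k i)))"
        by (rule eventually_compose_filterlim)
      then show "\<forall>\<^sub>F i in sequentially. y < ereal (lam (k i))"
        by eventually_elim (use upper less_le_trans in blast)
    qed
    show "liminf (\<lambda>i. ereal (lam (k i))) \<le> M_plus \<alpha> \<beta>"
      unfolding M_plus_def le_Liminf_iff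
    proof (intro allI impI)
      fix y
      assume "y < liminf (\<lambda>i. ereal (lam (k i)))"
      then have "\<forall>\<^sub>F i in sequentially. y < ereal (lam (k i))"
        using le_Liminf_iff[of "liminf (\<lambda>i. ereal (lam (k i)))" sequentially "\<lambda>i. ereal (lam (k i))"]
        by blast
      then obtain i1 where i1: "y < ereal (lam (k i))" if "i \<ge> i1" for i
        unfolding eventually_sequentially by blast
      define i0 where "i0 = max i1 (ncf_N \<alpha>)"
      have i0: "i0 \<ge> 1" "i0 \<ge> ncf_N \<alpha>" using N_ge_1 by (auto simp: i0_def)
      have yl: "y < ereal (lam (k i))" if "i \<ge> i0" for i using i1[of i] that by (simp add: i0_def)
      \<comment> \<open>Since \<open>lam (k i0) \<le> K\<close>, every alternative ending in
        \<open>K\<close> is harmless.\<close>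
      have yK: "y < ereal K"
        using yl[of i0] lam_k_le[OF i0] by (simp add: less_le_trans)
      have y_lam: "y < ereal (lam n)" if n: "k i0 \<le> n" for n
      proof -
        have "i0 \<le> i0 + Suc n" "n < k (i0 + Suc n)" using k_ge[of "i0 + Suc n"] by auto
        from bracket[of k, OF n this] obtain i where i: "i0 \<le> i" "k i \<le> n" "n < k (Suc i)"
          by blast
        have "lam n = lam (k i) \<or> lam n = lam (k (Suc i)) \<or> K \<le> lam n"
        proof (rule lam_between)
          show "\<not> (\<exists>j. {j..<j + ncf_N \<alpha> + s} \<subseteq> {k i + r<..<k (Suc i)} \<and>
              (\<forall>t\<in>{j..<j + ncf_N \<alpha> + s}. dav_coeff \<alpha> \<beta> t = 0))"
            using spec[OF assms(15), of i] i(1) i0(1) by simp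
        qed (use zeros[of i] i i0 in auto)
        then show ?thesis
          using yl[of i] yl[of "Suc i"] yK i(1) by (auto intro: less_le_trans)
      qed
      \<comment> \<open>Left ends of the windows in \<open>product_ge\<close>; they cover all large
        integers because \<open>q\<close> is unbounded.\<close>
      define g where "g n = Q (Suc (Suc n)) + q (Suc n)" for n
      have "y < ?f j" if j: "nat \<lceil>g (k i0)\<rceil> \<le> j" for j
      proof -
        have "g (k i0) \<le> real j" using j by linarith
        moreover have "k i0 \<le> k i0 + j" by simp
        moreover have "real j < g (k i0 + j)"
          using q_ge[of "Suc (k i0 + j)"] Q_nonneg[of "Suc (Suc (k i0 + j))"] by (simp add: g_def)
        ultimately obtain n where n: "k i0 \<le> n" "g n \<le> real j" "real j < g (Suc n)"
          using bracket[of g] by blast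
        obtain z where z: "z \<in> \<int>" "infdist (real j * \<alpha> - \<beta>) \<int> = dist (real j * \<alpha> - \<beta>) z"
          using infdist_attains_inf[OF closed_Ints] by (metis Ints_0 empty_iff)
        obtain p :: int where p: "z = of_int p" using z(1) by (elim Ints_cases)
        have e: "real j * infdist (real j * \<alpha> - \<beta>) \<int> =
            of_int (int j) * \<bar>of_int (int j) * \<alpha> - of_int p - \<beta>\<bar>"
          unfolding z(2) p by (simp add: dist_real_def algebra_simps)
        show ?thesis
          using product_ge[of n "int j" p] n yK y_lam[of "Suc (Suc n)"] y_lam[of "Suc (Suc (Suc n))"]
          unfolding e g_def by (auto intro: less_le_trans)
      qed
      then show "\<forall>\<^sub>F j in sequentially. y < ?f j"
        unfolding eventually_sequentially by blast
    qed
  qed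
qed

end
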